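(* Let $n,d\ge1$ and let $\boldsymbol{Q}\in\mathbb{R}^{dn\times dn}$ be a nonsingular block-factorizable matrix defined by matrices $\{\boldsymbol{U}_i\}_{i\in[n]}$ and $\{\boldsymbol{V}_i\}_{i\in[n]}$ in $\mathbb{R}^{d\times d}$, with every $\boldsymbol{U}_i$ nonsingular. Then $\boldsymbol{Q}^{-1}$ is a block tridiagonal matrix that can be decomposed into $n$ rank-$d$ matrices $$\boldsymbol{Q}^{-1}=\sum_{i=1}^n\boldsymbol{\Gamma}_i\boldsymbol{\Delta}_i\boldsymbol{\Gamma}_i^\top,$$ where $$\boldsymbol{\Gamma}_i=\boldsymbol{E}_i-\boldsymbol{E}_{i+1}\boldsymbol{\Theta}_{i+1}^\top,\quad i\in[n-1],\qquad \boldsymbol{\Gamma}_n=\boldsymbol{E}_n,$$ $$\boldsymbol{\Delta}_i=\left(\boldsymbol{U}_i\boldsymbol{V}_i^\top-\boldsymbol{U}_i\boldsymbol{U}_{i+1}^{-1}\boldsymbol{V}_{i+1}\boldsymbol{U}_i^\top\right)^{-1},\quad \boldsymbol{\Theta}_{i+1}=\boldsymbol{U}_i\boldsymbol{U}_{i+1}^{-1},\quad i\in[n-1],\qquad \boldsymbol{\Delta}_n=\left(\boldsymbol{U}_n\boldsymbol{V}_n^\top\right)^{-1}.$$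
   Context: $[n]=\{1,\dots,n\}$. Matrices in $\mathbb{R}^{dn\times dn}$ are viewed as having $n^2$ blocks of size $d\times d$, the $(i,j)$-th block of $\boldsymbol{Q}$ being $\boldsymbol{Q}_{[ij]}$. A symmetric matrix $\boldsymbol{Q}\in\mathbb{R}^{dn\times dn}$ is block-factorizable, defined by $\{\boldsymbol{U}_i\}_{i\in[n]}$, $\{\boldsymbol{V}_i\}_{i\in[n]}\subset\mathbb{R}^{d\times d}$, if $\boldsymbol{Q}_{[ij]}=\boldsymbol{U}_i\boldsymbol{V}_j^\top$ for all $i\le j$ (hence $\boldsymbol{Q}_{[ij]}=\boldsymbol{V}_i\boldsymbol{U}_j^\top$ for $i>j$ and each $\boldsymbol{U}_i\boldsymbol{V}_i^\top$ is symmetric). $\boldsymbol{E}_i\in\mathbb{R}^{dn\times d}$ is the block column whose $i$-th $d\times d$ block is the identity and whose other blocks are zero. *)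

theory Defs
  imports
    "Jordan_Normal_Form.Gauss_Jordan_Elimination"
    "Jordan_Normal_Form.DL_Rank"
begin

text \<open>
  Matrix entries are numbered from 0, as in the library, while block indices (and the families
  indexed by them) run through \<open>{1..n}\<close>: the \<open>i\<close>-th block occupies the rows
  \<open>(i - 1) * d, ..., i * d - 1\<close>.
\<close>

definition mat_block :: "nat \<Rightarrow> 'a mat \<Rightarrow> nat \<Rightarrow> nat \<Rightarrow> 'a mat" where
  "mat_block d Q i j = mat d d (\<lambda>(a, b). Q $$ ((i - 1) * d + a, (j - 1) * d + b))"

definition block_unit :: "nat \<Rightarrow> nat \<Rightarrow> nat \<Rightarrow> real mat" where
  "block_unit d n i = mat (n * d) d (\<lambda>(r, c). if r = (i - 1) * d + c then 1 else 0)"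

definition block_factorizable ::
    "nat \<Rightarrow> nat \<Rightarrow> real mat \<Rightarrow> (nat \<Rightarrow> real mat) \<Rightarrow> (nat \<Rightarrow> real mat) \<Rightarrow> bool" where
  "block_factorizable d n Q U V \<longleftrightarrow>
     Q \<in> carrier_mat (n * d) (n * d) \<and> Q\<^sup>T = Q \<and>
     (\<forall>i\<in>{1..n}. U i \<in> carrier_mat d d \<and> V i \<in> carrier_mat d d) \<and>
     (\<forall>i\<in>{1..n}. \<forall>j\<in>{1..n}. i \<le> j \<longrightarrow> mat_block d Q i j = U i * (V j)\<^sup>T)"

definition block_tridiagonal :: "nat \<Rightarrow> nat \<Rightarrow> real mat \<Rightarrow> bool" where
  "block_tridiagonal d n A \<longleftrightarrow>
     A \<in> carrier_mat (n * d) (n * d) \<and>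
     (\<forall>i\<in>{1..n}. \<forall>j\<in>{1..n}. i + 1 < j \<or> j + 1 < i \<longrightarrow> mat_block d A i j = 0\<^sub>m d d)"

text \<open>
  The inverse of a nonsingular matrix. For a singular argument the value is unspecified, so
  statements using it have to assert or assume nonsingularity separately.
\<close>

abbreviation mat_inv :: "'a :: field mat \<Rightarrow> 'a mat" where
  "mat_inv A \<equiv> the (mat_inverse A)"

text \<open>
  Matrices of all sizes share one type, so there is no \<open>comm_monoid_add\<close> instance; the sum is taken in
  the additive group of \<open>nr \<times> nc\<close> matrices and is meaningful only for summands of that size.
\<close>

abbreviation mat_sum :: "nat \<Rightarrow> nat \<Rightarrow> ('i \<Rightarrow> real mat) \<Rightarrow> 'i set \<Rightarrow> real mat" where
  "mat_sum nr nc \<equiv> finsum (module_mat TYPE(real) nr nc)"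

end

theory Submission
  imports Defs
begin

text \<open>
  Write \<open>E i\<close> for \<open>block_unit d n i\<close>, \<open>W i\<close> for the inverse of \<open>U i\<close> and \<open>D i\<close> for the matrix whose inverse is \<open>\<Delta> i\<close>. Block row \<open>i\<close>
  of \<open>Q\<close> minus \<open>\<Theta> (i + 1)\<close> times block row \<open>i + 1\<close> is \<open>(\<Gamma> i)\<^sup>T * Q\<close>; its \<open>j\<close>-th block vanishes for \<open>j > i\<close>
  and equals \<open>D i * (W i)\<^sup>T * (U j)\<^sup>T\<close> for \<open>j \<le> i\<close>. Hence the \<open>j\<close>-th block column of
  \<open>(\<Sum>i. \<Gamma> i * \<Delta> i * (\<Gamma> i)\<^sup>T) * Q\<close> is \<open>\<Sum>i\<ge>j. \<Gamma> i * (W i)\<^sup>T * (U j)\<^sup>T\<close>, and since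
  \<open>\<Gamma> i * (W i)\<^sup>T = F i - F (i + 1)\<close> with \<open>F i = E i * (W i)\<^sup>T\<close>, it telescopes to \<open>F j * (U j)\<^sup>T = E j\<close>.
\<close>

section \<open>Rank and inverses of matrices\<close>

text \<open>A left inverse of \<open>A\<close> makes its columns independent, and a right inverse of
  \<open>K\<close> makes \<open>K\<close> surjective, so \<open>A * K\<close> has the column space
  of \<open>A\<close>. Used for the rank of a single summand.\<close>

lemma (in vec_space) rank_mult_one_sided_inverses:
  assumes A: "A \<in> carrier_mat n d" and K: "K \<in> carrier_mat d m"
    and L: "L \<in> carrier_mat d n" and M: "M \<in> carrier_mat m d"
    and LA: "L * A = 1\<^sub>m d" and KM: "K * M = 1\<^sub>m d"
  shows "rank (A * K) = d"
proof -
  have AK: "A * K \<in> carrier_mat n m" using A K by simp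
  have inj: "x = y" if "x \<in> carrier_vec d" "y \<in> carrier_vec d" "A *\<^sub>v x = A *\<^sub>v y" for x y
  proof -
    have "x = L *\<^sub>v (A *\<^sub>v x)" using that LA assoc_mult_mat_vec[OF L A, of x] by simp
    also have "\<dots> = L *\<^sub>v (A *\<^sub>v y)" using that by simp
    also have "\<dots> = y" using that LA assoc_mult_mat_vec[OF L A, of y] by simp
    finally show ?thesis .
  qed
  have "col_space (A * K) = col_space A"
  proof -
    have "\<exists>z\<in>carrier_vec d. A *\<^sub>v z = (A * K) *\<^sub>v x" if "x \<in> carrier_vec m" for x
      using that A K by (intro bexI[of _ "K *\<^sub>v x"]) (auto simp: assoc_mult_mat_vec)
    moreover have "\<exists>z\<in>carrier_vec m. (A * K) *\<^sub>v z = A *\<^sub>v x" if x: "x \<in> carrier_vec d" for x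
    proof (intro bexI[of _ "M *\<^sub>v x"])
      have "(A * K) *\<^sub>v (M *\<^sub>v x) = A *\<^sub>v ((K * M) *\<^sub>v x)"
        using x A K M by (simp add: assoc_mult_mat_vec[of _ _ d] assoc_mult_mat_vec[of _ d m])
      then show "(A * K) *\<^sub>v (M *\<^sub>v x) = A *\<^sub>v x" using x KM by simp
    qed (use x M in auto)
    ultimately show ?thesis
      unfolding col_space_eq[OF AK] col_space_eq[OF A] using A K AK by (auto; metis)
  qed
  then have "rank (A * K) = rank A" unfolding rank_def col_space_def by simp
  also have "rank A = d"
  proof (rule lin_indpt_full_rank[OF A])
    \<comment> \<open>Independence concerns the set of columns, where a repetition would be lost;
      \<open>L\<close> sends the columns of \<open>A\<close> to distinct unit vectors.\<close>
    show dist: "distinct (cols A)"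
    proof (unfold distinct_conv_nth, intro allI impI notI)
      fix a b assume ab: "a < length (cols A)" "b < length (cols A)" "a \<noteq> b" "cols A ! a = cols A ! b"
      then have "col (L * A) a = col (L * A) b"
        using A by (simp add: col_mult2[OF L A])
      then have eq: "unit_vec d a = (unit_vec d b :: 'a vec)"
        using ab A by (simp add: LA)
      have "a < d" using ab A by simp
      with arg_cong[OF eq, of "\<lambda>v. v $ a"] ab A show False by (auto simp: unit_vec_def)
    qed
    show "lin_indpt (set (cols A))"
    proof
      assume "lin_dep (set (cols A))"
      from lin_depE[OF A this dist] obtain v where
        v: "v \<in> carrier_vec d" "v \<noteq> 0\<^sub>v d" "A *\<^sub>v v = 0\<^sub>v n" by blast
      have "A *\<^sub>v v = A *\<^sub>v 0\<^sub>v d" using v A by auto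
      with v inj[of v "0\<^sub>v d"] show False by simp
    qed
  qed
  finally show ?thesis .
qed

text \<open>For square matrices one product is enough. \<open>mat_inverse\<close> returns
  \<open>None\<close> only for non-units of the matrix ring, so \<open>the\<close> is applied to an
  actual inverse.\<close>

lemma mat_inv_of_inverse:
  fixes A :: "'a :: field mat"
  assumes A: "A \<in> carrier_mat n n" and B: "B \<in> carrier_mat n n" and AB: "A * B = 1\<^sub>m n"
  shows "invertible_mat A" "mat_inv A = B"
proof -
  have BA: "B * A = 1\<^sub>m n" by (rule mat_mult_left_right_inverse[OF A B AB])
  show "invertible_mat A"
    unfolding invertible_mat_def inverts_mat_def using A B AB BA by auto
  have "A \<in> Units (ring_mat TYPE('a) n ())"
    unfolding Units_def using A B AB BA by (auto simp: ring_mat_simps)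
  with mat_inverse(1)[OF A, where b = "()"] obtain C where C: "mat_inverse A = Some C" by fastforce
  from mat_inverse(2)[OF A C] have "C * A = 1\<^sub>m n" "C \<in> carrier_mat n n" by auto
  with AB assoc_mult_mat[of C n n A n B n] A B have "C = B" by simp
  with C show "mat_inv A = B" by simp
qed

text \<open>\<open>invertible_mat\<close> only provides some inverse of unstated size; comparing
  column counts in the two products makes it square of size \<open>n\<close>.\<close>

lemma invertible_mat_inv:
  fixes A :: "'a :: field mat"
  assumes "A \<in> carrier_mat n n" "invertible_mat A"
  shows "mat_inv A \<in> carrier_mat n n" "A * mat_inv A = 1\<^sub>m n" "mat_inv A * A = 1\<^sub>m n"
proof -
  from assms obtain B where AB: "A * B = 1\<^sub>m n" and BA: "B * A = 1\<^sub>m (dim_row B)"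
    unfolding invertible_mat_def inverts_mat_def by auto
  from arg_cong[OF AB, of dim_col] arg_cong[OF BA, of dim_col] assms
  have B: "B \<in> carrier_mat n n" by auto
  show "mat_inv A \<in> carrier_mat n n" "A * mat_inv A = 1\<^sub>m n" "mat_inv A * A = 1\<^sub>m n"
    using mat_inv_of_inverse(2)[OF assms(1) B AB] B AB mat_mult_left_right_inverse[OF assms(1) B AB]
    by auto
qed

text \<open>The cancellation in the induction step of \<open>telescope\<close>, with the operands in
  the order in which they occur there.\<close>

lemma minus_add_minus_mat:
  fixes A B C :: "'a :: ab_group_add mat"
  assumes "A \<in> carrier_mat r c" "B \<in> carrier_mat r c" "C \<in> carrier_mat r c"
  shows "(A - B) + (C - A) = C - B"
  using assms by (intro eq_matI) auto

section \<open>Finite sums of matrices\<close>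

lemma mat_sum_empty: "mat_sum r c f {} = 0\<^sub>m r c"
proof -
  interpret abelian_group "module_mat TYPE(real) r c" by (rule abelian_group_mat)
  show ?thesis by (simp add: module_mat_simps)
qed

lemma mat_sum_insert:
  assumes "finite I" "k \<notin> I" "\<And>i. i \<in> insert k I \<Longrightarrow> f i \<in> carrier_mat r c"
  shows "mat_sum r c f (insert k I) = f k + mat_sum r c f I"
proof -
  interpret abelian_group "module_mat TYPE(real) r c" by (rule abelian_group_mat)
  show ?thesis using assms by (subst finsum_insert) (auto simp: module_mat_simps)
qed

lemma mat_sum_carrier:
  assumes "\<And>i. i \<in> I \<Longrightarrow> f i \<in> carrier_mat r c"
  shows "mat_sum r c f I \<in> carrier_mat r c"
proof -
  interpret abelian_group "module_mat TYPE(real) r c" by (rule abelian_group_mat)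
  show ?thesis using finsum_closed[of f I] assms by (auto simp: module_mat_simps)
qed

lemma mat_sum_cong:
  assumes "\<And>i. i \<in> I \<Longrightarrow> f i = g i" "\<And>i. i \<in> I \<Longrightarrow> g i \<in> carrier_mat r c"
  shows "mat_sum r c f I = mat_sum r c g I"
proof -
  interpret abelian_group "module_mat TYPE(real) r c" by (rule abelian_group_mat)
  show ?thesis using assms by (intro finsum_cong') (auto simp: module_mat_simps)
qed

lemma mat_sum_zero:
  assumes "finite I" "\<And>i. i \<in> I \<Longrightarrow> f i = 0\<^sub>m r c"
  shows "mat_sum r c f I = 0\<^sub>m r c"
  using assms
proof (induction I)
  case (insert i I)
  then show ?case by (subst mat_sum_insert) auto
qed (simp add: mat_sum_empty)

lemma mat_sum_mult_right:
  assumes "finite I" "\<And>i. i \<in> I \<Longrightarrow> f i \<in> carrier_mat r c" "B \<in> carrier_mat c k"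
  shows "mat_sum r c f I * B = mat_sum r k (\<lambda>i. f i * B) I"
  using assms
proof (induction I)
  case (insert i I)
  have IH: "mat_sum r c f I * B = mat_sum r k (\<lambda>i. f i * B) I"
    using insert.IH insert.prems by blast
  have fB: "f j * B \<in> carrier_mat r k" if "j \<in> insert i I" for j
    using insert.prems(1)[OF that] insert.prems(2) by (rule mult_carrier_mat)
  have "mat_sum r c f (insert i I) * B = (f i + mat_sum r c f I) * B"
    using insert by (subst mat_sum_insert) auto
  also have "\<dots> = f i * B + mat_sum r c f I * B"
    by (rule add_mult_distrib_mat[of _ r c])
      (use insert in \<open>auto intro: mat_sum_carrier\<close>)
  also have "\<dots> = mat_sum r k (\<lambda>i. f i * B) (insert i I)"
    by (subst mat_sum_insert) (use insert.hyps fB IH in auto)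
  finally show ?case .
qed (simp add: mat_sum_empty)

lemma mat_sum_mult_left:
  assumes "finite I" "\<And>i. i \<in> I \<Longrightarrow> f i \<in> carrier_mat r c" "B \<in> carrier_mat k r"
  shows "B * mat_sum r c f I = mat_sum k c (\<lambda>i. B * f i) I"
  using assms
proof (induction I)
  case (insert i I)
  have IH: "B * mat_sum r c f I = mat_sum k c (\<lambda>i. B * f i) I"
    using insert.IH insert.prems by blast
  have Bf: "B * f j \<in> carrier_mat k c" if "j \<in> insert i I" for j
    using insert.prems(2) insert.prems(1)[OF that] by (rule mult_carrier_mat)
  have "B * mat_sum r c f (insert i I) = B * (f i + mat_sum r c f I)"
    using insert by (subst mat_sum_insert) auto
  also have "\<dots> = B * f i + B * mat_sum r c f I"
    by (rule mult_add_distrib_mat[of _ k r])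
      (use insert in \<open>auto intro: mat_sum_carrier\<close>)
  also have "\<dots> = mat_sum k c (\<lambda>i. B * f i) (insert i I)"
    by (subst mat_sum_insert) (use insert.hyps Bf IH in auto)
  finally show ?case .
qed (simp add: mat_sum_empty)

section \<open>Block units and block indices\<close>

lemma block_unit_carrier [simp]: "block_unit d n i \<in> carrier_mat (n * d) d"
  by (simp add: block_unit_def)

lemma dim_block_unit [simp]: "dim_row (block_unit d n i) = n * d" "dim_col (block_unit d n i) = d"
  by (simp_all add: block_unit_def)

lemma block_index_less:
  fixes i n d c :: nat
  assumes "i \<in> {1..n}" "c < d"
  shows "(i - 1) * d + c < n * d"
proof -
  have "(i - 1) * d + c < (i - 1) * d + d" using assms by simp
  also have "\<dots> = i * d" using assms by (cases i) auto
  also have "\<dots> \<le> n * d" using assms by simp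
  finally show ?thesis .
qed

text \<open>Column \<open>c\<close> of the block unit is the unit vector at
  \<open>(j - 1) * d + c\<close>, so a single term of the scalar product survives.\<close>

lemma index_mult_block_unit:
  assumes X: "X \<in> carrier_mat k (n * d)" and j: "j \<in> {1..n}" and a: "a < k" and c: "c < d"
  shows "(X * block_unit d n j) $$ (a, c) = X $$ (a, (j - 1) * d + c)"
proof -
  have "(X * block_unit d n j) $$ (a, c)
      = (\<Sum>r = 0..<n * d. X $$ (a, r) * (if (j - 1) * d + c = r then 1 else 0))"
    using X a c by (auto simp: scalar_prod_def block_unit_def intro!: sum.cong)
  also have "\<dots> = X $$ (a, (j - 1) * d + c)"
    using block_index_less[OF j c] by (simp add: if_distrib[of "\<lambda>x. _ * x"] cong: if_cong)
  finally show ?thesis .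
qed

lemma index_block_unit_mult:
  assumes X: "X \<in> carrier_mat (n * d) k" and i: "i \<in> {1..n}" and a: "a < d" and c: "c < k"
  shows "((block_unit d n i)\<^sup>T * X) $$ (a, c) = X $$ ((i - 1) * d + a, c)"
proof -
  have "((block_unit d n i)\<^sup>T * X) = (X\<^sup>T * block_unit d n i)\<^sup>T"
    using X by (subst transpose_mult[of _ k "n * d"]) auto
  then show ?thesis
    using index_mult_block_unit[of "X\<^sup>T" k n d i c a] block_index_less[OF i a] assms by simp
qed

text \<open>Extraction of a block becomes multiplication, so blocks of products and sums can be
  computed by associativity and distributivity instead of indices.\<close>

lemma mat_block_eq:
  assumes Q: "Q \<in> carrier_mat (n * d) (n * d)" and "i \<in> {1..n}" "j \<in> {1..n}"
  shows "mat_block d Q i j = (block_unit d n i)\<^sup>T * (Q * block_unit d n j)"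
proof (rule eq_matI)
  fix a b assume "a < dim_row ((block_unit d n i)\<^sup>T * (Q * block_unit d n j))"
    "b < dim_col ((block_unit d n i)\<^sup>T * (Q * block_unit d n j))"
  then have ab: "a < d" "b < d" by auto
  then have "((block_unit d n i)\<^sup>T * (Q * block_unit d n j)) $$ (a, b)
      = (Q * block_unit d n j) $$ ((i - 1) * d + a, b)"
    using assms by (intro index_block_unit_mult) auto
  also have "\<dots> = Q $$ ((i - 1) * d + a, (j - 1) * d + b)"
    using ab assms block_index_less by (intro index_mult_block_unit) auto
  finally show "mat_block d Q i j $$ (a, b) = ((block_unit d n i)\<^sup>T * (Q * block_unit d n j)) $$ (a, b)"
    using ab by (simp add: mat_block_def)
qed (auto simp: mat_block_def)

text \<open>\<open>Suc\<close> because blocks are numbered from 1; \<open>d = 0\<close> cannot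
  occur, since then \<open>n * d\<close> is 0.\<close>

lemma block_index_decomp:
  fixes r n d :: nat
  assumes "r < n * d"
  shows "Suc (r div d) \<in> {1..n}" "r mod d < d"
  using assms by (cases "d = 0"; auto simp: less_mult_imp_div_less Suc_le_eq)+

lemma block_columns_eqI:
  assumes X: "X \<in> carrier_mat k (n * d)" and Y: "Y \<in> carrier_mat k (n * d)"
    and eq: "\<And>j. j \<in> {1..n} \<Longrightarrow> X * block_unit d n j = Y * block_unit d n j"
  shows "X = Y"
proof (rule eq_matI)
  fix a r assume "a < dim_row Y" "r < dim_col Y"
  then have a: "a < k" and r: "r < n * d" using Y by auto
  note ir = block_index_decomp[OF r]
  show "X $$ (a, r) = Y $$ (a, r)"
    using eq[OF ir(1)] index_mult_block_unit[OF X ir(1) a ir(2)]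
      index_mult_block_unit[OF Y ir(1) a ir(2)] by simp
qed (use X Y in auto)

text \<open>Assembles a block row from prescribed blocks; \<open>D_invertible\<close> obtains its
  matrix \<open>R\<close> from it.\<close>

lemma block_row_exists:
  assumes F: "\<And>j. j \<in> {1..n} \<Longrightarrow> F j \<in> carrier_mat k d"
  shows "\<exists>R \<in> carrier_mat k (n * d). \<forall>j\<in>{1..n}. R * block_unit d n j = F j"
proof
  let ?R = "mat k (n * d) (\<lambda>(a, r). F (Suc (r div d)) $$ (a, r mod d))"
  show "?R \<in> carrier_mat k (n * d)" by simp
  show "\<forall>j\<in>{1..n}. ?R * block_unit d n j = F j"
  proof
    fix j assume j: "j \<in> {1..n}"
    show "?R * block_unit d n j = F j"
    proof (rule eq_matI)
      fix a c assume "a < dim_row (F j)" "c < dim_col (F j)"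
      then have ac: "a < k" "c < d" using F[OF j] by auto
      then show "(?R * block_unit d n j) $$ (a, c) = F j $$ (a, c)"
        using j block_index_less[OF j ac(2)] by (subst index_mult_block_unit) auto
    qed (use F[OF j] in auto)
  qed
qed

lemma block_unit_mult_block_unit:
  assumes "i \<in> {1..n}" "j \<in> {1..n}"
  shows "(block_unit d n i)\<^sup>T * block_unit d n j = (if i = j then 1\<^sub>m d else 0\<^sub>m d d)"
proof (rule eq_matI)
  fix a c assume "a < dim_row (if i = j then 1\<^sub>m d else 0\<^sub>m d d :: real mat)"
    "c < dim_col (if i = j then 1\<^sub>m d else 0\<^sub>m d d :: real mat)"
  then have ac: "a < d" "c < d" by (auto split: if_splits)
  \<comment> \<open>Quotient and remainder by \<open>d\<close> recover the block index and the
    position inside the block.\<close>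
  have iff: "(i - 1) * d + a = (j - 1) * d + c \<longleftrightarrow> i = j \<and> a = c"
  proof
    assume eq: "(i - 1) * d + a = (j - 1) * d + c"
    have "i - 1 = j - 1" using arg_cong[OF eq, of "\<lambda>x. x div d"] ac by simp
    moreover have "a = c" using arg_cong[OF eq, of "\<lambda>x. x mod d"] ac by simp
    ultimately show "i = j \<and> a = c" using assms by auto
  qed auto
  show "((block_unit d n i)\<^sup>T * block_unit d n j) $$ (a, c)
      = (if i = j then 1\<^sub>m d else 0\<^sub>m d d) $$ (a, c)"
    using ac block_index_less[OF assms(1) ac(1)] iff assms
    by (subst index_block_unit_mult) (auto simp: block_unit_def)
qed auto

text \<open>The ones would sit in rows from \<open>n * d\<close> on, beyond the last row.\<close>

lemma block_unit_beyond: "block_unit d n (Suc n) = 0\<^sub>m (n * d) d"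
  by (rule eq_matI) (auto simp: block_unit_def)

section \<open>The factors, extended to the index n + 1\<close>

text \<open>
  The convention \<open>U (n + 1) = W (n + 1) = 1\<close>, \<open>V (n + 1) = 0\<close> is used for the index \<open>n + 1\<close>, where also
  \<open>block_unit d n (n + 1) = 0\<close>: it makes the formulas for \<open>i = n\<close> instances of those for \<open>i < n\<close>.
\<close>

locale block_factors =
  fixes n d :: nat and Q :: "real mat" and U V W :: "nat \<Rightarrow> real mat"
  assumes Q_carrier: "Q \<in> carrier_mat (n * d) (n * d)"
    and U: "i \<in> {1..Suc n} \<Longrightarrow> U i \<in> carrier_mat d d"
    and V: "i \<in> {1..Suc n} \<Longrightarrow> V i \<in> carrier_mat d d"
    and W: "i \<in> {1..Suc n} \<Longrightarrow> W i \<in> carrier_mat d d"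
    and WU: "i \<in> {1..Suc n} \<Longrightarrow> W i * U i = 1\<^sub>m d"
    and V_last: "V (Suc n) = 0\<^sub>m d d"
    and upper: "1 \<le> i \<Longrightarrow> i \<le> j \<Longrightarrow> j \<le> n \<Longrightarrow>
      (block_unit d n i)\<^sup>T * (Q * block_unit d n j) = U i * (V j)\<^sup>T"
    and lower: "1 \<le> j \<Longrightarrow> j \<le> i \<Longrightarrow> i \<le> n \<Longrightarrow>
      (block_unit d n i)\<^sup>T * (Q * block_unit d n j) = V i * (U j)\<^sup>T"
begin

definition "E i = block_unit d n i"

definition "\<Theta> i = U (i - 1) * W i"

definition "\<Gamma> i = E i - E (Suc i) * (\<Theta> (Suc i))\<^sup>T"

text \<open>This is \<open>(\<Gamma> i)\<^sup>T * Q * \<Gamma> i\<close>: by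
  \<open>\<Gamma>_transpose_Q\<close>, block \<open>i\<close> of
  \<open>(\<Gamma> i)\<^sup>T * Q\<close> is \<open>D i\<close>, and the next block, if any, is
  zero.\<close>

definition "D i = U i * (V i)\<^sup>T - U i * W (Suc i) * V (Suc i) * (U i)\<^sup>T"

definition "F i = E i * (W i)\<^sup>T"

lemma E_carrier [simp]: "E i \<in> carrier_mat (n * d) d"
  by (simp add: E_def)

lemma dim_E [simp]: "dim_row (E i) = n * d" "dim_col (E i) = d"
  by (simp_all add: E_def)

lemma E_last: "E (Suc n) = 0\<^sub>m (n * d) d"
  by (simp add: E_def block_unit_beyond)

lemma \<Theta>_carrier: "i \<in> {1..n} \<Longrightarrow> \<Theta> (Suc i) \<in> carrier_mat d d"
  unfolding \<Theta>_def using U[of i] W[of "Suc i"] by simp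

lemma \<Gamma>_carrier: "i \<in> {1..n} \<Longrightarrow> \<Gamma> i \<in> carrier_mat (n * d) d"
  unfolding \<Gamma>_def using \<Theta>_carrier[of i] by (auto intro!: minus_carrier_mat)

lemma D_carrier: "i \<in> {1..n} \<Longrightarrow> D i \<in> carrier_mat d d"
  unfolding D_def using U[of i] by (auto intro!: minus_carrier_mat)

lemma F_carrier: "i \<in> {1..Suc n} \<Longrightarrow> F i \<in> carrier_mat (n * d) d"
  unfolding F_def using W[of i] by (intro mult_carrier_mat[of _ _ "d"]) auto

lemma UW: "i \<in> {1..Suc n} \<Longrightarrow> U i * W i = 1\<^sub>m d"
  using mat_mult_left_right_inverse[OF W U WU] by blast

lemma UW_transpose: "i \<in> {1..Suc n} \<Longrightarrow> (U i)\<^sup>T * (W i)\<^sup>T = 1\<^sub>m d"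
  using arg_cong[OF WU, of i transpose_mat] transpose_mult[OF W U, of i i] by simp

lemma WU_transpose: "i \<in> {1..Suc n} \<Longrightarrow> (W i)\<^sup>T * (U i)\<^sup>T = 1\<^sub>m d"
  using arg_cong[OF UW, of i transpose_mat] transpose_mult[OF U W, of i i] by simp

text \<open>The diagonal block falls under both \<open>upper\<close> and
  \<open>lower\<close>.\<close>

lemma UV_sym: "i \<in> {1..n} \<Longrightarrow> U i * (V i)\<^sup>T = V i * (U i)\<^sup>T"
  using upper[of i i] lower[of i i] by simp

section \<open>Differences of block rows\<close>

text \<open>Multiplication by the transpose is a block row operation on \<open>X\<close>; it is
  applied to \<open>E j\<close> and to \<open>Q * E j\<close>.\<close>

lemma \<Gamma>_transpose_mult:
  assumes i: "i \<in> {1..n}" and X: "X \<in> carrier_mat (n * d) k"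
  shows "(\<Gamma> i)\<^sup>T * X = (E i)\<^sup>T * X - \<Theta> (Suc i) * ((E (Suc i))\<^sup>T * X)"
proof -
  note T = \<Theta>_carrier[OF i]
  have ET: "E (Suc i) * (\<Theta> (Suc i))\<^sup>T \<in> carrier_mat (n * d) d"
    using T by (intro mult_carrier_mat[of _ _ "d"]) auto
  have "(\<Gamma> i)\<^sup>T = (E i)\<^sup>T - (E (Suc i) * (\<Theta> (Suc i))\<^sup>T)\<^sup>T"
    unfolding \<Gamma>_def using ET by (intro transpose_minus) auto
  also have "(E (Suc i) * (\<Theta> (Suc i))\<^sup>T)\<^sup>T = \<Theta> (Suc i) * (E (Suc i))\<^sup>T"
    using T by (subst transpose_mult[of _ "n * d" d _ d]) auto
  finally have "(\<Gamma> i)\<^sup>T * X = ((E i)\<^sup>T - \<Theta> (Suc i) * (E (Suc i))\<^sup>T) * X" by simp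
  also have "\<dots> = (E i)\<^sup>T * X - (\<Theta> (Suc i) * (E (Suc i))\<^sup>T) * X"
    using T X by (intro minus_mult_distrib_mat[of _ d "n * d"]) auto
  also have "(\<Theta> (Suc i) * (E (Suc i))\<^sup>T) * X = \<Theta> (Suc i) * ((E (Suc i))\<^sup>T * X)"
    using T X by (intro assoc_mult_mat[of _ d d _ "n * d"]) auto
  finally show ?thesis .
qed

lemma E_transpose_E:
  assumes "i \<in> {1..Suc n}" "j \<in> {1..n}"
  shows "(E i)\<^sup>T * E j = (if i = j then 1\<^sub>m d else 0\<^sub>m d d)"
proof (cases "i = Suc n")
  case True
  then show ?thesis using assms E_last by auto
next
  case False
  then show ?thesis using assms block_unit_mult_block_unit[of i n j d] by (simp add: E_def)
qed

lemma \<Gamma>_transpose_E: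
  assumes i: "i \<in> {1..n}" and j: "j \<in> {1..n}"
  shows "(\<Gamma> i)\<^sup>T * E j
    = (if j = i then 1\<^sub>m d else if j = Suc i then - \<Theta> (Suc i) else 0\<^sub>m d d)"
  using \<Gamma>_transpose_mult[OF i E_carrier] E_transpose_E[of i j] E_transpose_E[of "Suc i" j]
    \<Theta>_carrier[OF i] i j
  by (auto simp: minus_r_inv_mat intro!: eq_matI)

text \<open>Once the first product in \<open>D i\<close> is rewritten by \<open>UV_sym\<close>, both
  terms end in \<open>(U i)\<^sup>T\<close>, which cancels \<open>(W i)\<^sup>T\<close>.\<close>

lemma D_mult:
  assumes i: "i \<in> {1..n}" and j: "j \<in> {1..n}"
  shows "D i * ((W i)\<^sup>T * (U j)\<^sup>T) = V i * (U j)\<^sup>T - \<Theta> (Suc i) * (V (Suc i) * (U j)\<^sup>T)"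
proof -
  have c: "U i \<in> carrier_mat d d" "W i \<in> carrier_mat d d" "V i \<in> carrier_mat d d"
    "U j \<in> carrier_mat d d" "V (Suc i) \<in> carrier_mat d d" "W (Suc i) \<in> carrier_mat d d"
    "\<Theta> (Suc i) \<in> carrier_mat d d"
    using U V W \<Theta>_carrier i j by auto
  let ?X = "(W i)\<^sup>T * (U j)\<^sup>T"
  have X: "?X \<in> carrier_mat d d" using c by simp
  have "(U i)\<^sup>T * ?X = ((U i)\<^sup>T * (W i)\<^sup>T) * (U j)\<^sup>T"
    using c by (subst assoc_mult_mat[of _ d d _ d _ d]) auto
  also have "\<dots> = (U j)\<^sup>T" using UW_transpose[of i] i c by simp
  finally have UX: "(U i)\<^sup>T * ?X = (U j)\<^sup>T" .
  have "D i = V i * (U i)\<^sup>T - \<Theta> (Suc i) * V (Suc i) * (U i)\<^sup>T"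
    unfolding D_def \<Theta>_def using UV_sym[OF i] by simp
  then have "D i * ?X = V i * (U i)\<^sup>T * ?X - \<Theta> (Suc i) * V (Suc i) * (U i)\<^sup>T * ?X"
    using c X by (simp add: minus_mult_distrib_mat[of _ d d _ _ d])
  also have "V i * (U i)\<^sup>T * ?X = V i * (U j)\<^sup>T"
    using c X UX by (subst assoc_mult_mat[of _ d d _ d _ d]) auto
  also have "\<Theta> (Suc i) * V (Suc i) * (U i)\<^sup>T * ?X = \<Theta> (Suc i) * (V (Suc i) * (U j)\<^sup>T)"
    using c X UX by (simp add: assoc_mult_mat[of _ d d _ d _ d])
  finally show ?thesis .
qed

text \<open>For \<open>j \<le> i\<close>, column \<open>j\<close> meets block rows \<open>i\<close>
  and \<open>i + 1\<close> in the lower triangle, and \<open>D_mult\<close> applies. For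
  \<open>j > i\<close> it meets both in the upper triangle, diagonal included, where
  \<open>\<Theta> (Suc i)\<close> turns \<open>U (Suc i)\<close> into \<open>U i\<close> and the
  rows cancel.\<close>

lemma \<Gamma>_transpose_Q:
  assumes i: "i \<in> {1..n}" and j: "j \<in> {1..n}"
  shows "(\<Gamma> i)\<^sup>T * (Q * E j) = (if j \<le> i then D i * ((W i)\<^sup>T * (U j)\<^sup>T) else 0\<^sub>m d d)"
proof -
  have QE: "Q * E j \<in> carrier_mat (n * d) d" using Q_carrier by (intro mult_carrier_mat[of _ _ "n * d"]) auto
  note expand = \<Gamma>_transpose_mult[OF i QE]
  show ?thesis
  proof (cases "j \<le> i")
    case True
    have "(E (Suc i))\<^sup>T * (Q * E j) = V (Suc i) * (U j)\<^sup>T"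
    \<comment> \<open>There is no block row \<open>n + 1\<close>; both sides vanish because
      \<open>E (Suc n)\<close> and \<open>V (Suc n)\<close> are zero.\<close>
    proof (cases "i = n")
      case True
      then show ?thesis using V_last E_last left_mult_zero_mat[OF QE, of d] U[of j] j by simp
    next
      case False
      with i have "Suc i \<le> n" by simp
      then show ?thesis using lower[of j "Suc i"] True j by (simp add: E_def)
    qed
    moreover have "(E i)\<^sup>T * (Q * E j) = V i * (U j)\<^sup>T"
      using lower[of j i] True i j by (simp add: E_def)
    ultimately show ?thesis using expand D_mult[OF i j] True by simp
  next
    case False
    have c: "U i \<in> carrier_mat d d" "W (Suc i) \<in> carrier_mat d d"
      "U (Suc i) \<in> carrier_mat d d" "V j \<in> carrier_mat d d"
      using U V W i j by auto
    have "(E i)\<^sup>T * (Q * E j) = U i * (V j)\<^sup>T"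
      using upper[of i j] False i j by (simp add: E_def)
    moreover have "(E (Suc i))\<^sup>T * (Q * E j) = U (Suc i) * (V j)\<^sup>T"
      using upper[of "Suc i" j] False i j by (simp add: E_def)
    moreover have "\<Theta> (Suc i) * (U (Suc i) * (V j)\<^sup>T) = U i * (V j)\<^sup>T"
    proof -
      have "W (Suc i) * (U (Suc i) * (V j)\<^sup>T) = W (Suc i) * U (Suc i) * (V j)\<^sup>T"
        using c by (intro assoc_mult_mat[symmetric]) auto
      also have "\<dots> = (V j)\<^sup>T" using WU[of "Suc i"] c i by simp
      finally show ?thesis
        unfolding \<Theta>_def using c by (simp add: assoc_mult_mat[of _ d d _ d _ d])
    qed
    ultimately have "(\<Gamma> i)\<^sup>T * (Q * E j) = U i * (V j)\<^sup>T - U i * (V j)\<^sup>T"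
      using expand by simp
    also have "\<dots> = 0\<^sub>m d d" using c by (intro minus_r_inv_mat) simp
    finally show ?thesis using False by simp
  qed
qed

section \<open>The telescoping sum\<close>

text \<open>\<open>(\<Theta> (Suc i))\<^sup>T\<close> ends in \<open>(U i)\<^sup>T\<close>, which
  cancels \<open>(W i)\<^sup>T\<close>.\<close>

lemma \<Gamma>_W:
  assumes i: "i \<in> {1..n}"
  shows "\<Gamma> i * (W i)\<^sup>T = F i - F (Suc i)"
proof -
  have c: "U i \<in> carrier_mat d d" "W i \<in> carrier_mat d d" "W (Suc i) \<in> carrier_mat d d"
    using U W i by auto
  have T: "(\<Theta> (Suc i))\<^sup>T = (W (Suc i))\<^sup>T * (U i)\<^sup>T"
    unfolding \<Theta>_def using c by (simp add: transpose_mult[of _ d d _ d])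
  have "\<Gamma> i * (W i)\<^sup>T = E i * (W i)\<^sup>T - E (Suc i) * (\<Theta> (Suc i))\<^sup>T * (W i)\<^sup>T"
    unfolding \<Gamma>_def T using c
    by (intro minus_mult_distrib_mat[of _ "n * d" d]) (auto intro!: mult_carrier_mat[of _ _ "d"])
  also have "E (Suc i) * (\<Theta> (Suc i))\<^sup>T * (W i)\<^sup>T
      = E (Suc i) * ((W (Suc i))\<^sup>T * ((U i)\<^sup>T * (W i)\<^sup>T))"
    unfolding T using c
    by (simp add: assoc_mult_mat[of _ "n * d" d _ d _ d] assoc_mult_mat[of _ d d _ d _ d])
  also have "\<dots> = F (Suc i)" using UW_transpose[of i] i c by (simp add: F_def)
  finally show ?thesis by (simp add: F_def)
qed

text \<open>The upper limit \<open>m\<close> is separated from \<open>n\<close> for the induction;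
  the sum starts at \<open>i = j\<close>, where \<open>F j * (U j)\<^sup>T = E j\<close>.\<close>

lemma telescope:
  assumes j: "j \<in> {1..n}" and m: "m \<le> n"
  shows "mat_sum (n * d) d (\<lambda>i. if j \<le> i then (F i - F (Suc i)) * (U j)\<^sup>T else 0\<^sub>m (n * d) d) {1..m}
    = (if j \<le> m then E j - F (Suc m) * (U j)\<^sup>T else 0\<^sub>m (n * d) d)"
  using m
proof (induction m)
  case 0
  then show ?case using j by (simp add: mat_sum_empty)
next
  case (Suc m)
  have c: "U j \<in> carrier_mat d d" "F (Suc m) \<in> carrier_mat (n * d) d"
    "F (Suc (Suc m)) \<in> carrier_mat (n * d) d"
    using U F_carrier Suc.prems j by auto
  have FU: "F (Suc m) * (U j)\<^sup>T \<in> carrier_mat (n * d) d"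
    "F (Suc (Suc m)) * (U j)\<^sup>T \<in> carrier_mat (n * d) d"
    using c by (auto intro!: mult_carrier_mat[of _ _ d])
  let ?f = "\<lambda>i. if j \<le> i then (F i - F (Suc i)) * (U j)\<^sup>T else 0\<^sub>m (n * d) d"
  have f: "?f i \<in> carrier_mat (n * d) d" if "i \<in> {1..Suc m}" for i
    using that F_carrier[of "Suc i"] F_carrier[of i] c(1) Suc.prems
    by (auto intro!: mult_carrier_mat[of _ _ d] minus_carrier_mat)
  have "{1..Suc m} = insert (Suc m) {1..m}" by auto
  then have "mat_sum (n * d) d ?f {1..Suc m} = ?f (Suc m) + mat_sum (n * d) d ?f {1..m}"
    using f by (simp only:) (rule mat_sum_insert; auto)
  also have "mat_sum (n * d) d ?f {1..m} = (if j \<le> m then E j - F (Suc m) * (U j)\<^sup>T else 0\<^sub>m (n * d) d)"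
    using Suc by simp
  also have "?f (Suc m) + \<dots> = (if j \<le> Suc m then E j - F (Suc (Suc m)) * (U j)\<^sup>T else 0\<^sub>m (n * d) d)"
  proof -
    have step: "(F (Suc m) - F (Suc (Suc m))) * (U j)\<^sup>T
        = F (Suc m) * (U j)\<^sup>T - F (Suc (Suc m)) * (U j)\<^sup>T"
      using c by (intro minus_mult_distrib_mat) auto
    have "F j * (U j)\<^sup>T = E j * ((W j)\<^sup>T * (U j)\<^sup>T)"
      unfolding F_def using W[of j] U[of j] j by (intro assoc_mult_mat[of _ "n * d" d _ d _ d]) auto
    also have "\<dots> = E j" using WU_transpose[of j] j by simp
    finally have FUj: "F j * (U j)\<^sup>T = E j" .
    \<comment> \<open>The new index lies after the start of the sum, at it, or before it; at the
      start the previous partial sum is zero.\<close>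
    consider "j \<le> m" | "j = Suc m" | "j > Suc m" by linarith
    then show ?thesis
    proof cases
      case 1
      then show ?thesis unfolding step using minus_add_minus_mat[OF FU E_carrier] by simp
    next
      case 2
      then show ?thesis unfolding step
        using FUj right_add_zero_mat[OF minus_carrier_mat[OF FU(2)]] by simp
    qed auto
  qed
  finally show ?case .
qed

text \<open>\<open>telescope\<close> at \<open>m = n\<close> leaves a boundary term with
  \<open>F (Suc n)\<close>, which is zero because \<open>E (Suc n)\<close> is.\<close>

lemma sum_\<Gamma>_W_U:
  assumes j: "j \<in> {1..n}"
  shows "mat_sum (n * d) d (\<lambda>i. if j \<le> i then \<Gamma> i * ((W i)\<^sup>T * (U j)\<^sup>T) else 0\<^sub>m (n * d) d) {1..n} = E j"
proof -
  have Uj: "U j \<in> carrier_mat d d" using U j by simp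
  have "mat_sum (n * d) d (\<lambda>i. if j \<le> i then \<Gamma> i * ((W i)\<^sup>T * (U j)\<^sup>T) else 0\<^sub>m (n * d) d) {1..n}
    = mat_sum (n * d) d (\<lambda>i. if j \<le> i then (F i - F (Suc i)) * (U j)\<^sup>T else 0\<^sub>m (n * d) d) {1..n}"
  proof (rule mat_sum_cong)
    fix i assume i: "i \<in> {1..n}"
    then show "(if j \<le> i then \<Gamma> i * ((W i)\<^sup>T * (U j)\<^sup>T) else 0\<^sub>m (n * d) d)
        = (if j \<le> i then (F i - F (Suc i)) * (U j)\<^sup>T else 0\<^sub>m (n * d) d)"
      using assoc_mult_mat[of "\<Gamma> i" "n * d" d "(W i)\<^sup>T" d "(U j)\<^sup>T" d] \<Gamma>_carrier[OF i] W[of i] Uj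
      by (simp add: \<Gamma>_W)
    show "(if j \<le> i then (F i - F (Suc i)) * (U j)\<^sup>T else 0\<^sub>m (n * d) d) \<in> carrier_mat (n * d) d"
      using F_carrier[of i] F_carrier[of "Suc i"] i Uj
      by (auto intro!: mult_carrier_mat[of _ _ d] minus_carrier_mat)
  qed
  also have "\<dots> = E j - F (Suc n) * (U j)\<^sup>T" using telescope[OF j, of n] j by simp
  also have "F (Suc n) * (U j)\<^sup>T = 0\<^sub>m (n * d) d"
    unfolding F_def E_last using W[of "Suc n"] Uj by simp
  finally show ?thesis by (auto intro!: eq_matI simp: E_def)
qed

section \<open>Invertibility of the middle factors\<close>

text \<open>
  Reading the identities \<open>\<Gamma>_transpose_Q\<close> as \<open>(\<Gamma> i)\<^sup>T * Q = D i * R\<close> for a block row \<open>R\<close>, the \<open>i\<close>-th block of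
  \<open>(\<Gamma> i)\<^sup>T = D i * (R * mat_inv Q)\<close> exhibits a right inverse of \<open>D i\<close>.
\<close>

lemma D_invertible:
  assumes inv: "invertible_mat Q" and i: "i \<in> {1..n}"
  shows "invertible_mat (D i)"
proof -
  note B = invertible_mat_inv[OF Q_carrier inv]
  let ?B = "mat_inv Q"
  have "\<exists>R\<in>carrier_mat d (n * d). \<forall>j\<in>{1..n}. R * block_unit d n j
      = (if j \<le> i then (W i)\<^sup>T * (U j)\<^sup>T else 0\<^sub>m d d)"
    using W[of i] U i by (intro block_row_exists) auto
  then obtain R where R: "R \<in> carrier_mat d (n * d)"
    and RE: "\<And>j. j \<in> {1..n} \<Longrightarrow> R * E j = (if j \<le> i then (W i)\<^sup>T * (U j)\<^sup>T else 0\<^sub>m d d)"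
    unfolding E_def by blast
  note G = \<Gamma>_carrier[OF i] and D = D_carrier[OF i]
  have GQ: "(\<Gamma> i)\<^sup>T * Q = D i * R"
  proof (rule block_columns_eqI)
    fix j assume j: "j \<in> {1..n}"
    have "((\<Gamma> i)\<^sup>T * Q) * E j = (\<Gamma> i)\<^sup>T * (Q * E j)"
      using G Q_carrier by (intro assoc_mult_mat) auto
    also have "\<dots> = D i * (R * E j)" using \<Gamma>_transpose_Q[OF i j] RE[OF j] D by simp
    also have "\<dots> = (D i * R) * E j" using D R by (intro assoc_mult_mat[symmetric]) auto
    finally show "((\<Gamma> i)\<^sup>T * Q) * block_unit d n j = (D i * R) * block_unit d n j"
      by (simp add: E_def)
  qed (use G Q_carrier D R in auto)
  have "(\<Gamma> i)\<^sup>T = (\<Gamma> i)\<^sup>T * (Q * ?B)" using B G by simp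
  also have "\<dots> = (D i * R) * ?B" unfolding GQ[symmetric]
    using G Q_carrier B(1) by (intro assoc_mult_mat[symmetric]) auto
  also have "\<dots> = D i * (R * ?B)" using D R B(1) by (intro assoc_mult_mat) auto
  finally have "(\<Gamma> i)\<^sup>T * E i = D i * (R * ?B) * E i" by simp
  also have "\<dots> = D i * (R * ?B * E i)" using D R B(1) by (intro assoc_mult_mat[of _ d d _ "n * d" _ d]) auto
  finally have "D i * (R * ?B * E i) = 1\<^sub>m d" using \<Gamma>_transpose_E[OF i i] by simp
  then show ?thesis
    using D R B(1) by (intro mat_inv_of_inverse(1)[of _ d "R * ?B * E i"])
      (auto intro!: mult_carrier_mat[of _ _ "n * d"])
qed

section \<open>The inverse, its block pattern and the rank of its summands\<close>

definition "S = mat_sum (n * d) (n * d) (\<lambda>i. \<Gamma> i * mat_inv (D i) * (\<Gamma> i)\<^sup>T) {1..n}"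

context
  assumes inv: "invertible_mat Q"
begin

text \<open>Carrier and invertibility each contribute a premise on \<open>i\<close>, hence the
  double \<open>OF i i\<close> below.\<close>

lemmas D_inv = invertible_mat_inv[OF D_carrier D_invertible[OF inv]]

lemma term_carrier:
  "i \<in> {1..n} \<Longrightarrow> \<Gamma> i * mat_inv (D i) * (\<Gamma> i)\<^sup>T \<in> carrier_mat (n * d) (n * d)"
  using \<Gamma>_carrier D_inv(1) by (meson mult_carrier_mat transpose_carrier_mat)

lemma S_carrier: "S \<in> carrier_mat (n * d) (n * d)"
  unfolding S_def by (intro mat_sum_carrier term_carrier)

text \<open>The bracketing isolates \<open>(\<Gamma> i)\<^sup>T * X\<close>, which is known for
  \<open>X = Q * E j\<close> and \<open>X = E j\<close>.\<close>

lemma term_mult: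
  assumes i: "i \<in> {1..n}" and X: "X \<in> carrier_mat (n * d) k"
  shows "\<Gamma> i * mat_inv (D i) * (\<Gamma> i)\<^sup>T * X = \<Gamma> i * (mat_inv (D i) * ((\<Gamma> i)\<^sup>T * X))"
  using \<Gamma>_carrier[OF i] D_inv(1)[OF i i] X
  by (simp add: assoc_mult_mat[of _ "n * d" d _ "n * d" _ k] assoc_mult_mat[of _ "n * d" d _ d _ k])

text \<open>Only \<open>S * Q = 1\<close> is verified, on each block column; for square matrices the
  other product follows.\<close>

lemma mat_inv_Q: "mat_inv Q = S"
proof -
  have "S * Q = 1\<^sub>m (n * d)"
  proof (rule block_columns_eqI)
    fix j assume j: "j \<in> {1..n}"
    have QE: "Q * E j \<in> carrier_mat (n * d) d" using Q_carrier by (intro mult_carrier_mat[of _ _ "n * d"]) auto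
    have "S * Q * E j = S * (Q * E j)"
      using S_carrier Q_carrier by (intro assoc_mult_mat) auto
    also have "\<dots> = mat_sum (n * d) d (\<lambda>i. \<Gamma> i * mat_inv (D i) * (\<Gamma> i)\<^sup>T * (Q * E j)) {1..n}"
      unfolding S_def using QE term_carrier by (intro mat_sum_mult_right) auto
    also have "\<dots> = mat_sum (n * d) d
        (\<lambda>i. if j \<le> i then \<Gamma> i * ((W i)\<^sup>T * (U j)\<^sup>T) else 0\<^sub>m (n * d) d) {1..n}"
    proof (rule mat_sum_cong)
      fix i assume i: "i \<in> {1..n}"
      have c: "(W i)\<^sup>T * (U j)\<^sup>T \<in> carrier_mat d d" using W[of i] U[of j] i j by simp
      then have "mat_inv (D i) * (D i * ((W i)\<^sup>T * (U j)\<^sup>T)) = (W i)\<^sup>T * (U j)\<^sup>T"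
        using D_inv[OF i i] D_carrier[OF i] left_mult_one_mat[OF c]
        by (simp flip: assoc_mult_mat[of _ d d _ d _ d])
      then show "\<Gamma> i * mat_inv (D i) * (\<Gamma> i)\<^sup>T * (Q * E j)
          = (if j \<le> i then \<Gamma> i * ((W i)\<^sup>T * (U j)\<^sup>T) else 0\<^sub>m (n * d) d)"
        using term_mult[OF i QE] \<Gamma>_transpose_Q[OF i j] D_inv(1)[OF i i] \<Gamma>_carrier[OF i] by simp
      show "(if j \<le> i then \<Gamma> i * ((W i)\<^sup>T * (U j)\<^sup>T) else 0\<^sub>m (n * d) d) \<in> carrier_mat (n * d) d"
        using c \<Gamma>_carrier[OF i] by (auto intro!: mult_carrier_mat[of _ _ "d"])
    qed
    also have "\<dots> = E j" by (rule sum_\<Gamma>_W_U[OF j])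
    finally show "S * Q * block_unit d n j = 1\<^sub>m (n * d) * block_unit d n j"
      by (simp add: E_def)
  qed (use S_carrier Q_carrier in auto)
  from mat_mult_left_right_inverse[OF S_carrier Q_carrier this]
  show ?thesis by (rule mat_inv_of_inverse(2)[OF Q_carrier S_carrier])
qed

text \<open>\<open>\<Gamma> i\<close> has nonzero blocks at most at \<open>i\<close> and
  \<open>i + 1\<close>, so its summand reaches only blocks with both indices among these
  two.\<close>

lemma S_tridiagonal: "block_tridiagonal d n S"
  unfolding block_tridiagonal_def
proof (intro conjI ballI impI)
  fix a b assume a: "a \<in> {1..n}" and b: "b \<in> {1..n}" and far: "a + 1 < b \<or> b + 1 < a"
  have SE: "S * E b = mat_sum (n * d) d (\<lambda>i. \<Gamma> i * mat_inv (D i) * (\<Gamma> i)\<^sup>T * E b) {1..n}"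
    unfolding S_def using term_carrier by (intro mat_sum_mult_right) auto
  have "(E a)\<^sup>T * (S * E b)
      = mat_sum d d (\<lambda>i. (E a)\<^sup>T * (\<Gamma> i * mat_inv (D i) * (\<Gamma> i)\<^sup>T * E b)) {1..n}"
    unfolding SE using mult_carrier_mat[OF term_carrier E_carrier]
    by (intro mat_sum_mult_left) auto
  also have "\<dots> = 0\<^sub>m d d"
  proof (rule mat_sum_zero)
    fix i assume i: "i \<in> {1..n}"
    note c = D_inv(1)[OF i i] \<Gamma>_carrier[OF i]
    \<comment> \<open>The left factor is brought into the form
      \<open>(\<Gamma> i)\<^sup>T * E a\<close> too, so that \<open>\<Gamma>_transpose_E\<close>
      covers both sides.\<close>
    have eq: "(E a)\<^sup>T * (\<Gamma> i * mat_inv (D i) * (\<Gamma> i)\<^sup>T * E b)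
        = ((\<Gamma> i)\<^sup>T * E a)\<^sup>T * (mat_inv (D i) * ((\<Gamma> i)\<^sup>T * E b))"
      using c unfolding term_mult[OF i E_carrier]
      by (subst transpose_mult[of _ d "n * d" _ d]; simp add: assoc_mult_mat[of _ d "n * d" _ d _ d])
    from far consider "(\<Gamma> i)\<^sup>T * E a = 0\<^sub>m d d" | "(\<Gamma> i)\<^sup>T * E b = 0\<^sub>m d d"
      using \<Gamma>_transpose_E[OF i a] \<Gamma>_transpose_E[OF i b] by (auto split: if_splits)
    then show "(E a)\<^sup>T * (\<Gamma> i * mat_inv (D i) * (\<Gamma> i)\<^sup>T * E b) = 0\<^sub>m d d"
      unfolding eq using c by cases auto
  qed simp
  finally show "mat_block d S a b = 0\<^sub>m d d"
    using mat_block_eq[OF S_carrier a b] by (simp add: E_def)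
qed (rule S_carrier)

text \<open>With \<open>A = \<Gamma> i\<close> and
  \<open>K = mat_inv (D i) * (\<Gamma> i)\<^sup>T\<close>, the one-sided inverses are
  \<open>(E i)\<^sup>T\<close> and \<open>E i * D i\<close>, both because block \<open>i\<close> of
  \<open>\<Gamma> i\<close> is the identity.\<close>

lemma term_rank:
  assumes i: "i \<in> {1..n}"
  shows "vec_space.rank (n * d) (\<Gamma> i * mat_inv (D i) * (\<Gamma> i)\<^sup>T) = d"
proof -
  note c = D_inv[OF i i] \<Gamma>_carrier[OF i] D_carrier[OF i]
  have GE: "(\<Gamma> i)\<^sup>T * E i = 1\<^sub>m d" using \<Gamma>_transpose_E[OF i i] by simp
  have "(E i)\<^sup>T * \<Gamma> i = ((\<Gamma> i)\<^sup>T * E i)\<^sup>T" using c by (subst transpose_mult[of _ d "n * d" _ d]) auto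
  then have EG: "(E i)\<^sup>T * \<Gamma> i = 1\<^sub>m d" using GE by simp
  have "mat_inv (D i) * (\<Gamma> i)\<^sup>T * (E i * D i) = mat_inv (D i) * ((\<Gamma> i)\<^sup>T * (E i * D i))"
    using c by (intro assoc_mult_mat[of _ d d _ "n * d" _ d]) (auto intro!: mult_carrier_mat[of _ _ "d"])
  also have "(\<Gamma> i)\<^sup>T * (E i * D i) = D i"
    using c GE by (simp flip: assoc_mult_mat[of _ d "n * d" _ d _ d])
  finally have "mat_inv (D i) * (\<Gamma> i)\<^sup>T * (E i * D i) = 1\<^sub>m d" using c by simp
  moreover have "\<Gamma> i * mat_inv (D i) * (\<Gamma> i)\<^sup>T = \<Gamma> i * (mat_inv (D i) * (\<Gamma> i)\<^sup>T)"
    using c by (intro assoc_mult_mat[of _ "n * d" d _ d _ "n * d"]) auto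
  ultimately show ?thesis using c EG
    by (simp, intro vec_space.rank_mult_one_sided_inverses[of _ "n * d" d _ "n * d" "(E i)\<^sup>T" "E i * D i"])
      (auto intro!: mult_carrier_mat[of _ _ "d"])
qed

end

end

section \<open>Transfer to the given families\<close>

theorem proposition7:
  fixes n d :: nat
    and Q :: "real mat"
    and U V \<Gamma> \<Delta> \<Theta> :: "nat \<Rightarrow> real mat"
  assumes "n \<ge> 1" and "d \<ge> 1"
    and "block_factorizable d n Q U V"
    and "invertible_mat Q"
    and "\<And>i. i \<in> {1..n} \<Longrightarrow> invertible_mat (U i)"
    and "\<And>i. i \<in> {1..<n} \<Longrightarrow> \<Theta> (i + 1) = U i * mat_inv (U (i + 1))"
    and "\<And>i. i \<in> {1..<n} \<Longrightarrow>
           \<Gamma> i = block_unit d n i - block_unit d n (i + 1) * (\<Theta> (i + 1))\<^sup>T"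
    and "\<Gamma> n = block_unit d n n"
    and "\<And>i. i \<in> {1..<n} \<Longrightarrow>
           \<Delta> i = mat_inv (U i * (V i)\<^sup>T - U i * mat_inv (U (i + 1)) * V (i + 1) * (U i)\<^sup>T)"
    and "\<Delta> n = mat_inv (U n * (V n)\<^sup>T)"
  shows "block_tridiagonal d n (mat_inv Q)
    \<and> (\<forall>i\<in>{1..<n}. invertible_mat
          (U i * (V i)\<^sup>T - U i * mat_inv (U (i + 1)) * V (i + 1) * (U i)\<^sup>T))
    \<and> invertible_mat (U n * (V n)\<^sup>T)
    \<and> (\<forall>i\<in>{1..n}. vec_space.rank (n * d) (\<Gamma> i * \<Delta> i * (\<Gamma> i)\<^sup>T) = d)
    \<and> mat_inv Q = mat_sum (n * d) (n * d) (\<lambda>i. \<Gamma> i * \<Delta> i * (\<Gamma> i)\<^sup>T) {1..n}"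
proof -
  have Q: "Q \<in> carrier_mat (n * d) (n * d)" and sym: "Q\<^sup>T = Q"
    and Uc: "\<And>i. i \<in> {1..n} \<Longrightarrow> U i \<in> carrier_mat d d"
    and Vc: "\<And>i. i \<in> {1..n} \<Longrightarrow> V i \<in> carrier_mat d d"
    and blk: "\<And>i j. 1 \<le> i \<Longrightarrow> i \<le> j \<Longrightarrow> j \<le> n \<Longrightarrow> mat_block d Q i j = U i * (V j)\<^sup>T"
    using assms(3) unfolding block_factorizable_def by auto
  note Uinv = invertible_mat_inv[OF Uc assms(5)]
  \<comment> \<open>The locale also asks for factors at \<open>n + 1\<close>; these paddings satisfy
    its assumptions there.\<close>
  define U' where "U' i = (if i \<le> n then U i else 1\<^sub>m d)" for i
  define V' where "V' i = (if i \<le> n then V i else 0\<^sub>m d d)" for i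
  define W where "W i = (if i \<le> n then mat_inv (U i) else 1\<^sub>m d)" for i
  have upper: "(block_unit d n i)\<^sup>T * (Q * block_unit d n j) = U i * (V j)\<^sup>T"
    if "1 \<le> i" "i \<le> j" "j \<le> n" for i j
    using mat_block_eq[OF Q, of i j] blk[of i j] that by simp
  \<comment> \<open>Symmetry of \<open>Q\<close> makes this the transpose of the block given by
    \<open>upper\<close> for \<open>j\<close> and \<open>i\<close>.\<close>
  have lower: "(block_unit d n i)\<^sup>T * (Q * block_unit d n j) = V i * (U j)\<^sup>T"
    if "1 \<le> j" "j \<le> i" "i \<le> n" for i j
  proof -
    have "(block_unit d n i)\<^sup>T * (Q * block_unit d n j)
        = ((block_unit d n j)\<^sup>T * (Q * block_unit d n i))\<^sup>T"
      using Q sym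
      by (simp add: transpose_mult[of _ d "n * d" _ d] transpose_mult[of _ "n * d" "n * d" _ d]
          assoc_mult_mat[of _ d "n * d" _ "n * d" _ d])
    also have "\<dots> = V i * (U j)\<^sup>T"
      using upper[of j i] Uc[of j] Vc[of i] that by (simp add: transpose_mult[of _ d d _ d])
    finally show ?thesis .
  qed
  interpret block_factors n d Q U' V' W
    by unfold_locales
      (auto simp: U'_def V'_def W_def Q Uc Vc Uinv upper lower)
  \<comment> \<open>The qualified constant is the locale's matrix, the plain name the given family;
    at \<open>i = n\<close> they agree because the block unit at \<open>n + 1\<close> is
    zero.\<close>
  have \<Gamma>_eq: "block_factors.\<Gamma> n d U' W i = \<Gamma> i" if i: "i \<in> {1..n}" for i
  proof (cases "i = n")
    case True
    have "block_factors.\<Gamma> n d U' W n = block_unit d n n - 0\<^sub>m (n * d) d"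
      using Uc[of n] assms(1) by (simp add: \<Gamma>_def E_def block_unit_beyond \<Theta>_def U'_def W_def)
    with True assms(8) show ?thesis by (auto intro!: eq_matI)
  next
    case False
    then show ?thesis using assms(6,7)[of i] i by (simp add: \<Gamma>_def E_def \<Theta>_def U'_def W_def)
  qed
  \<comment> \<open>The second term of \<open>D n\<close> contains the factor
    \<open>V' (Suc n)\<close>, which is zero.\<close>
  have D_n: "D n = U n * (V n)\<^sup>T"
  proof -
    have "D n = U n * (V n)\<^sup>T - 0\<^sub>m d d"
      using Uc[of n] assms(1) by (simp add: D_def U'_def V'_def W_def)
    then show ?thesis using Uc[of n] Vc[of n] assms(1) by (auto intro!: eq_matI)
  qed
  have D_less: "D i = U i * (V i)\<^sup>T - U i * mat_inv (U (i + 1)) * V (i + 1) * (U i)\<^sup>T"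
    if "i \<in> {1..<n}" for i
    using that by (simp add: D_def U'_def V'_def W_def)
  have \<Delta>_eq: "mat_inv (D i) = \<Delta> i" if "i \<in> {1..n}" for i
    using that assms(9)[of i] assms(10) D_less[of i] D_n by (cases "i = n") auto
  have "S = mat_sum (n * d) (n * d) (\<lambda>i. \<Gamma> i * \<Delta> i * (\<Gamma> i)\<^sup>T) {1..n}"
    unfolding S_def using term_carrier[OF assms(4)]
    by (intro mat_sum_cong) (auto simp: \<Gamma>_eq \<Delta>_eq)
  moreover have "vec_space.rank (n * d) (\<Gamma> i * \<Delta> i * (\<Gamma> i)\<^sup>T) = d" if "i \<in> {1..n}" for i
    using term_rank[OF assms(4) that] that by (simp add: \<Gamma>_eq \<Delta>_eq)
  moreover have "invertible_mat (U i * (V i)\<^sup>T - U i * mat_inv (U (i + 1)) * V (i + 1) * (U i)\<^sup>T)"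
    if "i \<in> {1..<n}" for i
    using D_invertible[OF assms(4), of i] D_less[OF that] that by simp
  moreover have "invertible_mat (U n * (V n)\<^sup>T)"
    using D_invertible[OF assms(4), of n] D_n assms(1) by simp
  ultimately show ?thesis
    using mat_inv_Q[OF assms(4)] S_tridiagonal[OF assms(4)] by auto
qed

end
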